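(* Let $\Sigma =\overline{\mathbf{C}} \setminus \{ 0, \infty \}$, let $a, b \in \mathbf{R} \setminus \{ 0, 1\}$, and let $l, m, n$ be positive integers satisfying $$m+n >2l-2\geq 2, \quad m-l\neq -1, \quad n-l\neq -1 .$$ Define on $\Sigma$ $$g_{1}(z)= \frac{z^m -a}{z^m- 1},\qquad g_{2}(z)= \frac{z^n -b}{z^n -1},\qquad h\,dz= \frac{(z^m -1)(z^n -1)}{z^l}\,dz .$$ Then there is a complete minimal surface $X\colon \Sigma \to \mathbf{R}^4$ whose Weierstrass data is $(g_1,g_2,h\,dz)$. In particular, this surface has finite total curvature, $g_{1}$ omits the two values $1, a$ and $g_{2}$ omits the two values $1, b$.
   Context: $\overline{\mathbf{C}}=\mathbf{C}\cup\{\infty\}$ is the Riemann sphere and $\mathrm{i}=\sqrt{-1}$. Weierstrass data in $\mathbf{R}^4$: given meromorphic functions $g_1,g_2$ and a holomorphic differential $h\,dz$ on a Riemann surface $\Sigma$, put $$\phi_1=\tfrac12(1+g_1g_2)h\,dz,\quad \phi_2=\tfrac{\mathrm{i}}2(1-g_1g_2)h\,dz,\quad \phi_3=\tfrac12(g_1-g_2)h\,dz,\quad \phi_4=-\tfrac{\mathrm{i}}2(g_1+g_2)h\,dz .$$ The triple $(g_1,g_2,h\,dz)$ is the Weierstrass data of a minimal surface $X\colon\Sigma\to\mathbf{R}^4$ if the $\phi_i$ are holomorphic without common zeros (equivalently, the zero divisor of $h\,dz$ is the sum of the polar divisors of $g_1$ and $g_2$), $\mathrm{Re}\int_c\phi_i=0$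 for $i=1,2,3,4$ and every cycle $c\in H_1(\Sigma,\mathbf{Z})$, and, up to translation, $X(z)=\mathrm{Re}\left(\int_{z_0}^z2\phi_1,\dots,\int_{z_0}^z2\phi_4\right)$ for a fixed $z_0\in\Sigma$. Then $g=(g_1,g_2)\colon\Sigma\to\overline{\mathbf{C}}\times\overline{\mathbf{C}}$ is the Gauss map of $X$, and the induced metric is $ds^2=|h|^2(1+|g_1|^2)(1+|g_2|^2)|dz|^2$. The surface is complete if all divergent paths in $\Sigma$ have infinite length with respect to $ds^2$. The total curvature is $\int_\Sigma K\,dA$, where $K$ is the Gauss curvature and $dA$ the area element of $ds^2$; it is finite if this integral is finite. A value $\alpha\in\overline{\mathbf{C}}$ is omitted by $g_i$ if $g_i$ never attains $\alpha$ on $\Sigma$. *)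

theory Defs
  imports "HOL-Complex_Analysis.Complex_Analysis"
begin

text \<open>
  Riemann surfaces are represented here by connected open sets of the complex plane with their
  standard coordinate \<open>z\<close>.  The Riemann sphere is the one-point compactification of the plane; as
  in the library's \<open>Alexandroff_compactification\<close>, it is modelled by \<open>option\<close>.
\<close>

type_synonym rsphere = "complex option"

abbreviation sphere_inf :: rsphere
  where "sphere_inf \<equiv> None"

definition finite_points :: "rsphere set \<Rightarrow> complex set"
  where "finite_points A = {z. Some z \<in> A}"

text \<open>
  Value in the sphere of a meromorphic function.  HOL functions are total, so a meromorphic
  function given by a quotient has a meaningless value at its singularities (\<open>x / 0 = 0\<close>).
\<close>

definition sphere_value :: "(complex \<Rightarrow> complex) \<Rightarrow> complex \<Rightarrow> rsphere"
  where "sphere_value f z = (if is_pole f z then sphere_inf else Some (remove_sings f z))"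

definition omits :: "complex set \<Rightarrow> (complex \<Rightarrow> complex) \<Rightarrow> rsphere \<Rightarrow> bool"
  where "omits S f \<alpha> \<longleftrightarrow> (\<forall>z\<in>S. sphere_value f z \<noteq> \<alpha>)"


section \<open>Conformally parametrized surfaces\<close>

definition dirderiv :: "complex \<Rightarrow> (complex \<Rightarrow> 'b::real_normed_vector) \<Rightarrow> complex \<Rightarrow> 'b"
  where "dirderiv v f z = vector_derivative (\<lambda>t::real. f (z + t *\<^sub>R v)) (at 0)"

abbreviation partial_x :: "(complex \<Rightarrow> 'b::real_normed_vector) \<Rightarrow> complex \<Rightarrow> 'b"
  where "partial_x \<equiv> dirderiv 1"

abbreviation partial_y :: "(complex \<Rightarrow> 'b::real_normed_vector) \<Rightarrow> complex \<Rightarrow> 'b"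
  where "partial_y \<equiv> dirderiv \<i>"

text \<open>Class \<open>C\<^sup>\<infinity>\<close>: all iterated partial derivatives exist and are differentiable.\<close>

definition smooth_map_on :: "complex set \<Rightarrow> (complex \<Rightarrow> 'b::real_normed_vector) \<Rightarrow> bool"
  where "smooth_map_on S f \<longleftrightarrow>
    (\<forall>vs. set vs \<subseteq> {1, \<i>} \<longrightarrow> (\<forall>z\<in>S. foldr dirderiv vs f differentiable (at z)))"

definition conformal_immersion :: "complex set \<Rightarrow> (complex \<Rightarrow> 'b::euclidean_space) \<Rightarrow> bool"
  where "conformal_immersion S X \<longleftrightarrow> smooth_map_on S X \<and>
    (\<forall>z\<in>S. partial_x X z \<noteq> 0 \<and> norm (partial_x X z) = norm (partial_y X z) \<and>
            partial_x X z \<bullet> partial_y X z = 0)"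

text \<open>
  The metric induced by a conformal immersion is \<open>ds\<^sup>2 = metric_density X z |dz|\<^sup>2\<close>.  For a surface
  with Weierstrass data \<open>(g1, g2, h dz)\<close> as defined below, the density is
  \<open>|h|\<^sup>2 (1 + |g1|\<^sup>2) (1 + |g2|\<^sup>2)\<close> away from the poles of \<open>g1\<close> and \<open>g2\<close>.
\<close>

definition metric_density :: "(complex \<Rightarrow> 'b::euclidean_space) \<Rightarrow> complex \<Rightarrow> real"
  where "metric_density X z = (norm (partial_x X z))\<^sup>2"

text \<open>The normal component is taken by subtracting the orthogonal projection to the tangent plane.\<close>

definition second_fundamental_form ::
    "(complex \<Rightarrow> 'b::euclidean_space) \<Rightarrow> complex \<Rightarrow> complex \<Rightarrow> complex \<Rightarrow> 'b"
  where "second_fundamental_form X z v w =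
    dirderiv v (dirderiv w X) z
      - closest_point (span {partial_x X z, partial_y X z}) (dirderiv v (dirderiv w X) z)"

text \<open>Half the trace with respect to the induced metric; this formula needs \<open>X\<close> conformal.\<close>

definition mean_curvature_vector :: "(complex \<Rightarrow> 'b::euclidean_space) \<Rightarrow> complex \<Rightarrow> 'b"
  where "mean_curvature_vector X z =
    (1 / (2 * metric_density X z)) *\<^sub>R
      (second_fundamental_form X z 1 1 + second_fundamental_form X z \<i> \<i>)"

definition minimal_surface :: "complex set \<Rightarrow> (complex \<Rightarrow> 'b::euclidean_space) \<Rightarrow> bool"
  where "minimal_surface S X \<longleftrightarrow> open S \<and> connected S \<and> S \<noteq> {} \<and> conformal_immersion S X \<and>
    (\<forall>z\<in>S. mean_curvature_vector X z = 0)"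

text \<open>Paths are parametrized by \<open>[0, 1)\<close> and leave every compact subset of the surface.\<close>

definition divergent_path :: "complex set \<Rightarrow> (real \<Rightarrow> complex) \<Rightarrow> bool"
  where "divergent_path S \<gamma> \<longleftrightarrow>
    (\<forall>s\<in>{0<..<1}. \<gamma> piecewise_C1_differentiable_on {0..s}) \<and> \<gamma> ` {0..<1} \<subseteq> S \<and>
    (\<forall>K. compact K \<and> K \<subseteq> S \<longrightarrow> eventually (\<lambda>t. \<gamma> t \<notin> K) (at_left 1))"

definition induced_length ::
    "(complex \<Rightarrow> 'b::euclidean_space) \<Rightarrow> (real \<Rightarrow> complex) \<Rightarrow> ennreal"
  where "induced_length X \<gamma> =
    (\<integral>\<^sup>+t\<in>{0..<1}. ennreal (sqrt (metric_density X (\<gamma> t)) * norm (vector_derivative \<gamma> (at t))) \<partial>lborel)"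

definition complete_surface :: "complex set \<Rightarrow> (complex \<Rightarrow> 'b::euclidean_space) \<Rightarrow> bool"
  where "complete_surface S X \<longleftrightarrow> (\<forall>\<gamma>. divergent_path S \<gamma> \<longrightarrow> induced_length X \<gamma> = \<infinity>)"

text \<open>Gauss curvature of a conformal metric: \<open>K = - \<Delta> (log \<lambda>) / (2 \<lambda>)\<close> for \<open>ds\<^sup>2 = \<lambda> |dz|\<^sup>2\<close>.\<close>

definition gauss_curvature :: "(complex \<Rightarrow> 'b::euclidean_space) \<Rightarrow> complex \<Rightarrow> real"
  where "gauss_curvature X z =
    - (partial_x (partial_x (\<lambda>w. ln (metric_density X w))) z +
       partial_y (partial_y (\<lambda>w. ln (metric_density X w))) z) / (2 * metric_density X z)"

text \<open>Integrability of \<open>K dA\<close>, where \<open>dA = \<lambda> dx dy\<close>.\<close>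

definition finite_total_curvature :: "complex set \<Rightarrow> (complex \<Rightarrow> 'b::euclidean_space) \<Rightarrow> bool"
  where "finite_total_curvature S X \<longleftrightarrow>
    set_integrable lborel S (\<lambda>z. gauss_curvature X z * metric_density X z)"


section \<open>Weierstrass data in four-space\<close>

text \<open>
  The coefficients of the forms \<open>\<phi>\<^sub>k\<close> with respect to \<open>dz\<close>.  The singularities have to be removed,
  since the poles of \<open>g1\<close> and \<open>g2\<close> may cancel against the zeros of \<open>h\<close>.
\<close>

definition weierstrass_form ::
    "(complex \<Rightarrow> complex) \<Rightarrow> (complex \<Rightarrow> complex) \<Rightarrow> (complex \<Rightarrow> complex) \<Rightarrow> 4 \<Rightarrow> complex \<Rightarrow> complex"
  where "weierstrass_form g1 g2 h k = remove_sings (\<lambda>z. (vector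
     [ 1 / 2 * (1 + g1 z * g2 z) * h z,
       \<i> / 2 * (1 - g1 z * g2 z) * h z,
       1 / 2 * (g1 z - g2 z) * h z,
       - (\<i> / 2) * (g1 z + g2 z) * h z ] :: complex^4) $ k)"

text \<open>
  Cycles in the period condition are represented by closed piecewise \<open>C\<^sup>1\<close> paths, which generate
  the first homology group.
\<close>

definition weierstrass_data ::
    "complex set \<Rightarrow> (complex \<Rightarrow> complex) \<Rightarrow> (complex \<Rightarrow> complex) \<Rightarrow> (complex \<Rightarrow> complex)
      \<Rightarrow> (complex \<Rightarrow> real^4) \<Rightarrow> bool"
  where "weierstrass_data S g1 g2 h X \<longleftrightarrow>
    g1 meromorphic_on S \<and> g2 meromorphic_on S \<and> h holomorphic_on S \<and>
    (\<forall>k. weierstrass_form g1 g2 h k holomorphic_on S) \<and>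
    (\<forall>z\<in>S. \<exists>k. weierstrass_form g1 g2 h k z \<noteq> 0) \<and>
    (\<forall>c k. valid_path c \<and> path_image c \<subseteq> S \<and> pathfinish c = pathstart c \<longrightarrow>
       Re (contour_integral c (weierstrass_form g1 g2 h k)) = 0) \<and>
    (\<exists>z0\<in>S. \<exists>p. \<forall>c k. valid_path c \<and> path_image c \<subseteq> S \<and> pathstart c = z0 \<longrightarrow>
       X (pathfinish c) $ k =
         p $ k + Re (contour_integral c (\<lambda>z. 2 * weierstrass_form g1 g2 h k z)))"

end

theory Submission
  imports Defs "HOL-Probability.Sinc_Integral"
begin

text \<open>The data are written homogeneously, as \<open>g1 = s2 / s1\<close>, \<open>g2 = t2 / t1\<close>, \<open>h = s1 t1\<close> with
  \<open>s1 = (z ^ m - 1) / z ^ l\<close>, \<open>s2 = (z ^ m - a) / z ^ l\<close>, \<open>t1 = z ^ n - 1\<close>, \<open>t2 = z ^ n - b\<close>. The Weierstrass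
  forms are linear combinations of the four products \<open>s\<^sub>i t\<^sub>j\<close>. These are Laurent polynomials with the
  exponents \<open>m + n - l\<close>, \<open>m - l\<close>, \<open>n - l\<close> and \<open>- l\<close>. None of them is \<open>-1\<close> under the given conditions, so the
  products have single-valued primitives on the punctured plane (\<open>laurent_primitive\<close>). The surface
  \<open>X\<close> is the real part of the corresponding primitive \<open>G\<close> of \<open>2 \<phi>\<close>; it is well defined and all periods
  vanish. It is conformal and minimal because \<open>\<Sum> \<phi>\<^sub>k\<^sup>2 = 0\<close> (\<open>minimal_surface_re_vec\<close>), and an
  immersion because \<open>s1, s2\<close> have no common zero and neither have \<open>t1, t2\<close>.

  The induced metric has the density \<open>(|s1|\<^sup>2 + |s2|\<^sup>2) (|t1|\<^sup>2 + |t2|\<^sup>2)\<close>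
  (\<open>sum_norm_spinor_form\<close>). As \<open>a\<close> and \<open>b\<close> differ from \<open>1\<close>, it is at least a positive multiple of
  \<open>(1 + |z| ^ (2 m)) (1 + |z| ^ (2 n)) / |z| ^ (2 l)\<close>, and \<open>1 \<le> l \<le> m + n\<close> makes this at least
  \<open>1 / |z|\<^sup>2\<close>. The latter is the metric of a complete cylinder (\<open>complete_punctured_plane\<close>).

  The Laplacian of \<open>ln (|f|\<^sup>2 + |g|\<^sup>2)\<close> is four times the spherical density of \<open>g / f\<close>. Hence
  \<open>K dA\<close> is \<open>-2\<close> times the sum of the spherical densities of \<open>g1\<close> and \<open>g2\<close>
  (\<open>gauss_curvature_mult_density\<close>). Both functions are rational, and each density is bounded by a
  multiple of the area density of the sphere, which is integrable
  (\<open>integrable_spherical_density_power\<close>).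

  Finally \<open>g1\<close> is a Moebius transformation of \<open>z ^ m\<close> that takes the values \<open>1\<close> and \<open>a\<close> at \<open>\<infinity>\<close> and \<open>0\<close>,
  the two points that are missing; similarly for \<open>g2\<close> (\<open>omits_power_quotient\<close>).\<close>

section \<open>Real parts of holomorphic null curves\<close>

text \<open>\<open>dirderiv\<close> only sees \<open>f\<close> near the point, so it can be computed from any function that agrees with
  \<open>f\<close> on an open set. This makes iterated directional derivatives accessible: the inner one is
  replaced by its closed form before the outer one is taken.\<close>

lemma dirderiv_eq_on_open:
  assumes "(g has_derivative D) (at z)" "open S" "z \<in> S" "\<And>w. w \<in> S \<Longrightarrow> f w = g w"
  shows "dirderiv v f z = D v"
proof -
  have f: "(f has_derivative D) (at z)"
    using has_derivative_transform_within_open[OF assms(1-3)] assms(4) by metis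
  have l: "((\<lambda>t::real. z + t *\<^sub>R v) has_derivative (\<lambda>t. t *\<^sub>R v)) (at 0)"
    by (auto intro!: derivative_eq_intros)
  have "((\<lambda>t::real. f (z + t *\<^sub>R v)) has_derivative (\<lambda>t. D (t *\<^sub>R v))) (at 0)"
    by (rule has_derivative_compose[OF l]) (use f in simp)
  then have "((\<lambda>t::real. f (z + t *\<^sub>R v)) has_vector_derivative D v) (at 0)"
    using linear_scale[OF has_derivative_linear[OF f]] by (simp add: has_vector_derivative_def)
  then show ?thesis
    unfolding dirderiv_def by (rule vector_derivative_at)
qed

definition re_vec :: "('n::finite \<Rightarrow> complex \<Rightarrow> complex) \<Rightarrow> complex \<Rightarrow> real^'n"
  where "re_vec G z = (\<chi> k. Re (G k z))"

lemma re_vec_has_derivative: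
  assumes "\<And>k. (G k has_field_derivative d k) (at z)"
  shows "(re_vec G has_derivative (\<lambda>v. \<chi> k. Re (v * d k))) (at z)"
proof -
  have "((\<lambda>z. re_vec G z \<bullet> i) has_derivative (\<lambda>v. (\<chi> k. Re (v * d k)) \<bullet> i)) (at z)" if i: "i \<in> Basis" for i
  proof -
    obtain k where i: "i = axis k (1::real)"
      using i unfolding Basis_vec_def by auto
    have "((\<lambda>z. Re (G k z)) has_derivative (\<lambda>v. Re (d k * v))) (at z)"
      using assms[of k] by (intro has_derivative_Re) (simp add: has_field_derivative_def)
    then show ?thesis
      by (simp add: i re_vec_def inner_axis mult.commute)
  qed
  then show ?thesis
    by (subst has_derivative_componentwise_within) auto
qed

text \<open>For holomorphic \<open>G\<close>, differentiating \<open>Re G\<close> in direction \<open>v\<close> gives \<open>Re (v G')\<close>, again a real part of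
  the same kind, so the process can be repeated.\<close>

lemma foldr_dirderiv_re_vec:
  assumes S: "open S" and G: "\<And>k. G k holomorphic_on S" and z: "z \<in> S"
  shows "foldr dirderiv vs (re_vec G) z
    = re_vec (\<lambda>k w. prod_list vs * (deriv ^^ length vs) (G k) w) z"
  using z
proof (induction vs arbitrary: z)
  case Nil
  then show ?case by simp
next
  case (Cons v vs)
  have "((\<lambda>w. prod_list vs * (deriv ^^ length vs) (G k) w) has_field_derivative
      prod_list vs * deriv ((deriv ^^ length vs) (G k)) z) (at z)" for k
    using holomorphic_derivI[OF holomorphic_higher_deriv[OF G S] S Cons.prems]
    by (rule DERIV_cmult)
  from dirderiv_eq_on_open[OF re_vec_has_derivative[OF this] S Cons.prems Cons.IH]
  show ?case
    by (simp add: re_vec_def mult.assoc mult.left_commute)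
qed

lemma smooth_re_vec:
  assumes S: "open S" and G: "\<And>k. G k holomorphic_on S"
  shows "smooth_map_on S (re_vec G)"
  unfolding smooth_map_on_def
proof (intro allI impI ballI)
  fix vs :: "complex list" and z assume z: "z \<in> S"
  have "((\<lambda>w. prod_list vs * (deriv ^^ length vs) (G k) w) has_field_derivative
      prod_list vs * deriv ((deriv ^^ length vs) (G k)) z) (at z)" for k
    using holomorphic_derivI[OF holomorphic_higher_deriv[OF G S] S z]
    by (rule DERIV_cmult)
  from re_vec_has_derivative[OF this]
  have "(foldr dirderiv vs (re_vec G) has_derivative
      (\<lambda>v. \<chi> k. Re (v * (prod_list vs * deriv ((deriv ^^ length vs) (G k)) z)))) (at z)"
    by (rule has_derivative_transform_within_open[OF _ S z]) (simp add: foldr_dirderiv_re_vec[where G=G, OF S G])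
  then show "foldr dirderiv vs (re_vec G) differentiable (at z)"
    by (rule differentiableI)
qed

lemma closest_point_span_uminus:
  fixes x :: "'a::euclidean_space"
  shows "closest_point (span B) (- x) = - closest_point (span B) x"
proof -
  have ne: "span B \<noteq> {}" using span_zero by blast
  note cl = closed_span[of B]
  have "dist (- x) (- closest_point (span B) x) \<le> dist (- x) y" if "y \<in> span B" for y
    using closest_point_le[OF cl span_neg[OF that], of x]
    by (metis dist_minus minus_minus)
  then show ?thesis
    using closest_point_unique[OF subspace_imp_convex[OF subspace_span] cl, of "- closest_point (span B) x" "-x"]
      closest_point_in_set[OF cl ne] span_neg by metis
qed

text \<open>The real part of a holomorphic null immersion is minimal. With \<open>G' = \<phi>\<close>, the partial derivatives
  are \<open>Re \<phi>\<close> and \<open>- Im \<phi>\<close>, so the real and imaginary parts of \<open>\<Sum> \<phi>\<^sub>k\<^sup>2 = 0\<close> are the two conformality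
  equations. Harmonicity makes the second derivatives in the directions \<open>1\<close> and \<open>\<i>\<close> cancel; their
  tangential projections cancel with them, because the projection onto a linear subspace is odd.\<close>

lemma minimal_surface_re_vec:
  assumes S: "open S" "connected S" "S \<noteq> {}"
    and G: "\<And>k z. z \<in> S \<Longrightarrow> (G k has_field_derivative \<phi> k z) (at z)"
    and isotropic: "\<And>z. z \<in> S \<Longrightarrow> (\<Sum>k\<in>UNIV. (\<phi> k z)\<^sup>2) = 0"
    and nonzero: "\<And>z. z \<in> S \<Longrightarrow> \<exists>k. \<phi> k z \<noteq> 0"
  shows "minimal_surface S (re_vec G)"
proof -
  have hol: "G k holomorphic_on S" for k
    using G S(1) by (auto simp: holomorphic_on_open)
  have D: "dirderiv v (re_vec G) z = (\<chi> k. Re (v * \<phi> k z))" if "z \<in> S" for z v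
    using dirderiv_eq_on_open[OF re_vec_has_derivative[OF G[OF that]] S(1) that refl] .
  have DD: "dirderiv \<i> (dirderiv \<i> (re_vec G)) z = - dirderiv 1 (dirderiv 1 (re_vec G)) z"
    if "z \<in> S" for z
    using foldr_dirderiv_re_vec[where G=G and vs="[1, 1]", OF S(1) hol that]
      foldr_dirderiv_re_vec[where G=G and vs="[\<i>, \<i>]", OF S(1) hol that]
    by (simp add: re_vec_def vec_eq_iff)
  have "partial_x (re_vec G) z \<noteq> 0 \<and>
      norm (partial_x (re_vec G) z) = norm (partial_y (re_vec G) z) \<and>
      partial_x (re_vec G) z \<bullet> partial_y (re_vec G) z = 0" if z: "z \<in> S" for z
  proof -
    have "(\<Sum>k\<in>UNIV. (Re (\<phi> k z))\<^sup>2 - (Im (\<phi> k z))\<^sup>2) = Re (\<Sum>k\<in>UNIV. (\<phi> k z)\<^sup>2)"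
      by (simp add: power2_eq_square)
    then have re: "(\<Sum>k\<in>UNIV. (Re (\<phi> k z))\<^sup>2) = (\<Sum>k\<in>UNIV. (Im (\<phi> k z))\<^sup>2)"
      using isotropic[OF z] by (simp add: sum_subtractf)
    have "2 * (\<Sum>k\<in>UNIV. Re (\<phi> k z) * Im (\<phi> k z)) = Im (\<Sum>k\<in>UNIV. (\<phi> k z)\<^sup>2)"
      by (simp add: power2_eq_square sum_distrib_left mult.commute)
    then have im: "(\<Sum>k\<in>UNIV. Re (\<phi> k z) * Im (\<phi> k z)) = 0"
      using isotropic[OF z] by simp
    have "partial_x (re_vec G) z \<noteq> 0"
    proof
      assume "partial_x (re_vec G) z = 0"
      then have r: "\<And>k. Re (\<phi> k z) = 0" by (simp add: D[OF z] vec_eq_iff)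
      with re have "\<And>k. Im (\<phi> k z) = 0" by (simp add: sum_nonneg_eq_0_iff)
      with r nonzero[OF z] show False by (metis complex_eqI zero_complex.sel)
    qed
    moreover have "norm (partial_x (re_vec G) z) = norm (partial_y (re_vec G) z)"
      using re by (simp add: D[OF z] norm_vec_def L2_set_def)
    moreover have "partial_x (re_vec G) z \<bullet> partial_y (re_vec G) z = 0"
      using im by (simp add: D[OF z] inner_vec_def sum_negf)
    ultimately show ?thesis by blast
  qed
  moreover have "mean_curvature_vector (re_vec G) z = 0" if "z \<in> S" for z
    by (simp add: mean_curvature_vector_def second_fundamental_form_def DD[OF that]
        closest_point_span_uminus)
  ultimately show ?thesis
    using S smooth_re_vec[where G=G, OF S(1) hol] by (auto simp: minimal_surface_def conformal_immersion_def)
qed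

lemma holomorphic_on_derivative:
  assumes S: "open S" and G: "\<And>z. z \<in> S \<Longrightarrow> (G has_field_derivative c * \<phi> z) (at z)" and c: "c \<noteq> 0"
  shows "\<phi> holomorphic_on S"
proof -
  have "G holomorphic_on S" using G S by (auto simp: holomorphic_on_open)
  then have "(\<lambda>z. deriv G z / c) holomorphic_on S"
    using S c by (intro holomorphic_intros) auto
  then show ?thesis by (rule holomorphic_transform) (simp add: DERIV_imp_deriv[OF G] c)
qed

text \<open>For an isotropic vector \<open>\<phi>\<close> the real and the imaginary part have the same length, so each carries
  half of \<open>\<Sum> |\<phi>\<^sub>k|\<^sup>2\<close>.\<close>

lemma metric_density_re_vec:
  assumes G: "\<And>k. (G k has_field_derivative \<phi> k) (at z)"
    and isotropic: "(\<Sum>k\<in>UNIV. (\<phi> k)\<^sup>2) = 0"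
  shows "metric_density (re_vec G) z = (\<Sum>k\<in>UNIV. (norm (\<phi> k))\<^sup>2) / 2"
proof -
  have "partial_x (re_vec G) z = (\<chi> k. Re (\<phi> k))"
    using dirderiv_eq_on_open[OF re_vec_has_derivative[OF G] open_UNIV, where f="re_vec G" and v=1] by simp
  then have "metric_density (re_vec G) z = (\<Sum>k\<in>UNIV. (Re (\<phi> k))\<^sup>2)"
    by (simp add: metric_density_def norm_vec_def L2_set_def sum_nonneg)
  moreover have "(\<Sum>k\<in>UNIV. (Re (\<phi> k))\<^sup>2) - (\<Sum>k\<in>UNIV. (Im (\<phi> k))\<^sup>2) = Re (\<Sum>k\<in>UNIV. (\<phi> k)\<^sup>2)"
    by (simp add: power2_eq_square sum_subtractf)
  moreover have "(\<Sum>k\<in>UNIV. (norm (\<phi> k))\<^sup>2) = (\<Sum>k\<in>UNIV. (Re (\<phi> k))\<^sup>2) + (\<Sum>k\<in>UNIV. (Im (\<phi> k))\<^sup>2)"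
    by (simp add: cmod_power2 sum.distrib)
  ultimately show ?thesis using isotropic by simp
qed

section \<open>Completeness of metrics on the punctured plane\<close>

text \<open>A gauge integral need not converge absolutely. If it does not, the right-hand side is infinite;
  otherwise the function is Lebesgue integrable and the two notions of integral agree.\<close>

lemma abs_integral_le_nn_integral:
  fixes f :: "real \<Rightarrow> real"
  assumes "(f has_integral I) A"
  shows "ennreal \<bar>I\<bar> \<le> (\<integral>\<^sup>+t\<in>A. ennreal \<bar>f t\<bar> \<partial>lborel)"
proof (cases "(\<integral>\<^sup>+t\<in>A. ennreal \<bar>f t\<bar> \<partial>lborel) = \<infinity>")
  case True
  then show ?thesis by simp
next
  case False
  let ?g = "\<lambda>t. indicator A t *\<^sub>R f t"
  have eq: "(\<integral>\<^sup>+t. ennreal (norm (?g t)) \<partial>lebesgue) = (\<integral>\<^sup>+t\<in>A. ennreal \<bar>f t\<bar> \<partial>lborel)"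
    unfolding nn_integral_completion by (rule nn_integral_cong) (auto simp: indicator_def)
  have "(?g has_integral I) UNIV"
    using assms has_integral_restrict_UNIV[of A f I] indicator_scaleR_eq_if[of A _ f] by simp
  then have "?g \<in> lebesgue \<rightarrow>\<^sub>M borel"
    using has_integral_implies_lebesgue_measurable_real[of ?g I UNIV] by simp
  then have int: "integrable lebesgue ?g"
    using False unfolding integrable_iff_bounded eq by (simp add: top.not_eq_extremum)
  then have "(?g has_integral (integral\<^sup>L lebesgue ?g)) UNIV"
    by (rule has_integral_integral_lebesgue)
  with \<open>(?g has_integral I) UNIV\<close> have "I = integral\<^sup>L lebesgue ?g"
    using has_integral_unique by blast
  then show ?thesis
    using integral_norm_bound_ennreal[OF int] unfolding eq by simp
qed

text \<open>The metric \<open>|dz|\<^sup>2 / |z|\<^sup>2\<close> is the flat metric of an infinite cylinder: the length of a path is at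
  least the variation of \<open>ln |z|\<close> along it. A divergent path leaves every annulus
  \<open>exp (- M) \<le> |z| \<le> exp M\<close>, so \<open>ln |z|\<close> is unbounded along it, and any metric that dominates a
  multiple of the cylinder metric is complete.

  A piecewise \<open>C\<^sup>1\<close> path may have an unbounded derivative near the finitely many exceptional points,
  which is why the variation of \<open>ln |z|\<close> is bounded by means of the gauge integral.\<close>

lemma complete_punctured_plane:
  fixes X :: "complex \<Rightarrow> 'b::euclidean_space"
  assumes c: "c > 0" and X: "\<And>z. z \<noteq> 0 \<Longrightarrow> c / norm z \<le> sqrt (metric_density X z)"
  shows "complete_surface (- {0}) X"
  unfolding complete_surface_def
proof (intro allI impI)
  fix \<gamma> assume dp: "divergent_path (- {0}) \<gamma>"
  let ?L = "\<lambda>t. ln (norm (\<gamma> t))"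
  have nz: "\<gamma> t \<noteq> 0" if "0 \<le> t" "t < 1" for t
    using dp that by (auto simp: divergent_path_def image_subset_iff)
  have len: "ennreal (c * \<bar>?L s - ?L 0\<bar>) \<le> induced_length X \<gamma>" if s: "0 < s" "s < 1" for s
  proof -
    have "\<gamma> piecewise_C1_differentiable_on {0..s}"
      using dp s by (auto simp: divergent_path_def)
    then obtain T where cont: "continuous_on {0..s} \<gamma>" and T: "finite T"
      and C1: "\<gamma> C1_differentiable_on {0..s} - T"
      by (auto simp: piecewise_C1_differentiable_on_def)
    let ?d = "\<lambda>t. vector_derivative \<gamma> (at t)"
    let ?f = "\<lambda>t. (\<gamma> t \<bullet> ?d t) / (norm (\<gamma> t))\<^sup>2"
    have "(?f has_integral ?L s - ?L 0) {0..s}"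
    proof (rule fundamental_theorem_of_calculus_interior_strong[OF T])
      show "continuous_on {0..s} ?L"
        using cont nz s by (auto intro!: continuous_intros)
      fix t assume t: "t \<in> {0<..<s} - T"
      have d: "(\<gamma> has_derivative (\<lambda>h. h *\<^sub>R ?d t)) (at t)"
        using C1 t unfolding C1_differentiable_on_eq
        by (auto simp: vector_derivative_works has_vector_derivative_def)
      have g: "\<gamma> t \<noteq> 0" using nz t s by auto
      have "((\<lambda>t. norm (\<gamma> t)) has_derivative (\<lambda>h. (h *\<^sub>R ?d t) \<bullet> sgn (\<gamma> t))) (at t)"
        by (rule has_derivative_compose[OF d has_derivative_norm[OF g]])
      from has_derivative_ln[OF _ this] g
      have "(?L has_derivative (\<lambda>h. (h *\<^sub>R ?d t) \<bullet> sgn (\<gamma> t) * inverse (norm (\<gamma> t)))) (at t)"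
        by simp
      moreover have "(\<lambda>h. (h *\<^sub>R ?d t) \<bullet> sgn (\<gamma> t) * inverse (norm (\<gamma> t))) = (\<lambda>h. h *\<^sub>R ?f t)"
        by (simp add: sgn_div_norm inner_commute power2_eq_square divide_inverse ac_simps)
      ultimately show "(?L has_vector_derivative ?f t) (at t)"
        by (simp add: has_vector_derivative_def)
    qed (use s in auto)
    from abs_integral_le_nn_integral[OF has_integral_mult_right[OF this, of c]]
    have "ennreal (c * \<bar>?L s - ?L 0\<bar>) \<le> (\<integral>\<^sup>+t\<in>{0..s}. ennreal (c * \<bar>?f t\<bar>) \<partial>lborel)"
      using c by (simp add: abs_mult)
    also have "\<dots> \<le> induced_length X \<gamma>"
      unfolding induced_length_def
    proof (rule nn_integral_mono)
      fix t :: real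
      have "c * \<bar>?f t\<bar> \<le> sqrt (metric_density X (\<gamma> t)) * norm (?d t)" if t: "t \<in> {0..s}"
      proof -
        have g: "\<gamma> t \<noteq> 0" using nz t s by auto
        have "\<bar>?f t\<bar> \<le> norm (\<gamma> t) * norm (?d t) / (norm (\<gamma> t))\<^sup>2"
          using Cauchy_Schwarz_ineq2[of "\<gamma> t" "?d t"] by (simp add: divide_right_mono)
        then have "c * \<bar>?f t\<bar> \<le> c * (norm (\<gamma> t) * norm (?d t) / (norm (\<gamma> t))\<^sup>2)"
          using c by (intro mult_left_mono) auto
        also have "\<dots> = c / norm (\<gamma> t) * norm (?d t)"
          using g by (simp add: power2_eq_square)
        also have "\<dots> \<le> sqrt (metric_density X (\<gamma> t)) * norm (?d t)"
          using X[OF g] by (rule mult_right_mono) simp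
        finally show ?thesis .
      qed
      then show "ennreal (c * \<bar>?f t\<bar>) * indicator {0..s} t
        \<le> ennreal (sqrt (metric_density X (\<gamma> t)) * norm (?d t)) * indicator {0..<1} t"
        using s c by (auto simp: indicator_def intro!: ennreal_leI)
    qed
    finally show ?thesis .
  qed
  show "induced_length X \<gamma> = \<infinity>"
  proof (rule ccontr)
    assume "induced_length X \<gamma> \<noteq> \<infinity>"
    then obtain B where B: "B \<ge> 0" "induced_length X \<gamma> = ennreal B"
      by (cases "induced_length X \<gamma>") auto
    (* outside the annulus of logarithmic radius M the bound len exceeds B *)
    define M where "M = B / c + \<bar>?L 0\<bar>"
    let ?K = "cball 0 (exp M) - ball (0::complex) (exp (- M))"
    have "compact ?K" by (intro compact_diff) auto
    moreover have "?K \<subseteq> - {0}" by auto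
    ultimately have "eventually (\<lambda>t. \<gamma> t \<notin> ?K) (at_left 1)"
      using dp by (auto simp: divergent_path_def)
    moreover have "eventually (\<lambda>t. t \<in> {0<..<1}) (at_left (1::real))"
      by (rule eventually_at_leftI[of 0]) auto
    ultimately have "eventually (\<lambda>t. \<gamma> t \<notin> ?K \<and> t \<in> {0<..<1}) (at_left (1::real))"
      by (rule eventually_conj)
    then have "\<exists>s. \<gamma> s \<notin> ?K \<and> s \<in> {0<..<1}"
      by (rule eventually_happens'[rotated]) (rule trivial_limit_at_left_real)
    then obtain s where s: "\<gamma> s \<notin> ?K" "0 < s" "s < 1"
      by (auto simp only: greaterThanLessThan_iff)
    have g: "norm (\<gamma> s) > 0" using nz[of s] s by simp
    have "norm (\<gamma> s) > exp M \<or> norm (\<gamma> s) < exp (- M)"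
      using s(1) unfolding Diff_iff mem_cball mem_ball dist_0_norm by linarith
    then have "?L s > M \<or> ?L s < - M"
      using exp_less_cancel_iff[of M "?L s"] exp_less_cancel_iff[of "?L s" "- M"]
      unfolding exp_ln[OF g] by blast
    then have "B / c < \<bar>?L s - ?L 0\<bar>" unfolding M_def by linarith
    then have "B < c * \<bar>?L s - ?L 0\<bar>" using c by (simp add: pos_divide_less_eq mult.commute)
    moreover have "c * \<bar>?L s - ?L 0\<bar> \<le> B"
      using len[OF s(2,3)] unfolding B(2) ennreal_le_iff[OF B(1)] .
    ultimately show False by linarith
  qed
qed

section \<open>Curvature and spherical densities\<close>

text \<open>The density of the pull-back of the Fubini-Study metric under \<open>z \<mapsto> [f z : g z]\<close>, that is, the squared
  spherical derivative of the quotient \<open>g / f\<close> (up to normalization).\<close>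

definition spherical_density :: "(complex \<Rightarrow> complex) \<Rightarrow> (complex \<Rightarrow> complex) \<Rightarrow> complex \<Rightarrow> real"
  where "spherical_density f g z =
    (norm (f z * deriv g z - g z * deriv f z))\<^sup>2 / ((norm (f z))\<^sup>2 + (norm (g z))\<^sup>2)\<^sup>2"

definition ln_norm_deriv :: "(complex \<Rightarrow> complex) \<Rightarrow> (complex \<Rightarrow> complex) \<Rightarrow> complex \<Rightarrow> complex \<Rightarrow> real"
  where "ln_norm_deriv f g v z =
    2 * (f z \<bullet> (v * deriv f z) + g z \<bullet> (v * deriv g z)) / ((norm (f z))\<^sup>2 + (norm (g z))\<^sup>2)"

lemma ln_norm_has_derivative:
  assumes f: "(f has_field_derivative deriv f z) (at z)" and g: "(g has_field_derivative deriv g z) (at z)"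
    and nz: "f z \<noteq> 0 \<or> g z \<noteq> 0"
  shows "((\<lambda>w. ln ((norm (f w))\<^sup>2 + (norm (g w))\<^sup>2)) has_derivative (\<lambda>v. ln_norm_deriv f g v z)) (at z)"
proof -
  have A: "f z \<bullet> f z + g z \<bullet> g z > 0"
    using nz by (metis add_nonneg_pos add_pos_nonneg inner_ge_zero inner_gt_zero_iff)
  have "((\<lambda>w. ln (f w \<bullet> f w + g w \<bullet> g w)) has_derivative (\<lambda>v. ln_norm_deriv f g v z)) (at z)"
    using f[unfolded has_field_derivative_def] g[unfolded has_field_derivative_def] A
    by (auto intro!: derivative_eq_intros ext
        simp: ln_norm_deriv_def power2_norm_eq_inner inner_commute mult.commute field_simps)
  then show ?thesis by (simp add: power2_norm_eq_inner)
qed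

text \<open>The number \<open>D 1 1 + D \<i> \<i>\<close> is the Laplacian of \<open>ln (|f|\<^sup>2 + |g|\<^sup>2)\<close>. The terms with the second derivatives
  \<open>f2\<close> and \<open>g2\<close> cancel between the two directions, and what remains is a Gram determinant of \<open>(f, g)\<close> and
  \<open>(f', g')\<close>, hence the square of the Wronskian.\<close>

lemma ln_norm_deriv_has_derivative:
  assumes f: "(f has_field_derivative deriv f z) (at z)" "(deriv f has_field_derivative f2) (at z)"
    and g: "(g has_field_derivative deriv g z) (at z)" "(deriv g has_field_derivative g2) (at z)"
    and nz: "f z \<noteq> 0 \<or> g z \<noteq> 0"
  obtains D where "\<And>v. (ln_norm_deriv f g v has_derivative D v) (at z)"
    "D 1 1 + D \<i> \<i> = 4 * spherical_density f g z"
proof -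
  have A: "f z \<bullet> f z + g z \<bullet> g z > 0"
    using nz by (metis add_nonneg_pos add_pos_nonneg inner_ge_zero inner_gt_zero_iff)
  let ?A = "f z \<bullet> f z + g z \<bullet> g z"
  let ?N = "\<lambda>v. f z \<bullet> (v * deriv f z) + g z \<bullet> (v * deriv g z)"
  let ?D = "\<lambda>v w. (2 * ((w * deriv f z) \<bullet> (v * deriv f z) + f z \<bullet> (v * (w * f2))
       + (w * deriv g z) \<bullet> (v * deriv g z) + g z \<bullet> (v * (w * g2))) * ?A
       - 4 * ?N v * ?N w) / ?A\<^sup>2"
  have D: "(ln_norm_deriv f g v has_derivative ?D v) (at z)" for v
  proof -
    have "((\<lambda>z. 2 * (f z \<bullet> (v * deriv f z) + g z \<bullet> (v * deriv g z)) / (f z \<bullet> f z + g z \<bullet> g z))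
       has_derivative ?D v) (at z)"
      using f[unfolded has_field_derivative_def] g[unfolded has_field_derivative_def] A
      by (auto intro!: derivative_eq_intros ext simp: power2_eq_square divide_simps)
        (auto simp: inner_commute algebra_simps)
    then show ?thesis by (simp add: ln_norm_deriv_def[abs_def] power2_norm_eq_inner)
  qed
  have "?D 1 1 + ?D \<i> \<i> = 4 * (norm (f z * deriv g z - g z * deriv f z))\<^sup>2 / ?A\<^sup>2"
    unfolding add_divide_distrib[symmetric]
  proof (rule arg_cong[where f = "\<lambda>x. x / ?A\<^sup>2"])
    (* Lagrange's identity for the vectors (f, g) and (f', g'), in real coordinates *)
    show "(2 * ((1 * deriv f z) \<bullet> (1 * deriv f z) + f z \<bullet> (1 * (1 * f2))
         + (1 * deriv g z) \<bullet> (1 * deriv g z) + g z \<bullet> (1 * (1 * g2))) * ?A - 4 * ?N 1 * ?N 1)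
       + (2 * ((\<i> * deriv f z) \<bullet> (\<i> * deriv f z) + f z \<bullet> (\<i> * (\<i> * f2))
         + (\<i> * deriv g z) \<bullet> (\<i> * deriv g z) + g z \<bullet> (\<i> * (\<i> * g2))) * ?A - 4 * ?N \<i> * ?N \<i>)
       = 4 * (norm (f z * deriv g z - g z * deriv f z))\<^sup>2"
      unfolding cmod_power2 by (simp add: inner_complex_def power2_eq_square) (simp add: algebra_simps)
  qed
  then have "?D 1 1 + ?D \<i> \<i> = 4 * spherical_density f g z"
    by (simp add: spherical_density_def power2_norm_eq_inner)
  with D show ?thesis by (rule that)
qed

text \<open>The logarithm turns the product into a sum, so the curvature form splits into one term for each
  component of the Gauss map.\<close>

lemma gauss_curvature_mult_density:
  assumes S: "open S" "z \<in> S"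
    and hol: "s1 holomorphic_on S" "s2 holomorphic_on S" "t1 holomorphic_on S" "t2 holomorphic_on S"
    and nz: "\<And>w. w \<in> S \<Longrightarrow> s1 w \<noteq> 0 \<or> s2 w \<noteq> 0" "\<And>w. w \<in> S \<Longrightarrow> t1 w \<noteq> 0 \<or> t2 w \<noteq> 0"
    and X: "\<And>w. w \<in> S \<Longrightarrow> metric_density X w =
      ((norm (s1 w))\<^sup>2 + (norm (s2 w))\<^sup>2) * ((norm (t1 w))\<^sup>2 + (norm (t2 w))\<^sup>2)"
  shows "gauss_curvature X z * metric_density X z =
    - 2 * (spherical_density s1 s2 z + spherical_density t1 t2 z)"
proof -
  have der: "(f has_field_derivative deriv f w) (at w)" "(deriv f has_field_derivative deriv (deriv f) w) (at w)"
    if "f holomorphic_on S" "w \<in> S" for f w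
    using that S(1) by (auto intro: holomorphic_derivI holomorphic_deriv)
  have pos: "(norm x)\<^sup>2 + (norm y)\<^sup>2 > 0" if "x \<noteq> 0 \<or> y \<noteq> 0" for x y :: complex
    using that by (metis add_nonneg_pos add_pos_nonneg norm_eq_zero zero_le_power2 zero_less_power2)
  define ld where "ld v w = ln_norm_deriv s1 s2 v w + ln_norm_deriv t1 t2 v w" for v w
  have d1: "dirderiv v (\<lambda>w. ln (metric_density X w)) w = ld v w" if w: "w \<in> S" for v w
    unfolding ld_def
    by (rule dirderiv_eq_on_open[OF has_derivative_add[OF
        ln_norm_has_derivative[OF der(1)[OF hol(1) w] der(1)[OF hol(2) w] nz(1)[OF w]]
        ln_norm_has_derivative[OF der(1)[OF hol(3) w] der(1)[OF hol(4) w] nz(2)[OF w]]] S(1) w])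
      (simp add: X ln_mult_pos[OF pos[OF nz(1)] pos[OF nz(2)]])
  obtain D where D: "\<And>v. (ln_norm_deriv s1 s2 v has_derivative D v) (at z)"
    "D 1 1 + D \<i> \<i> = 4 * spherical_density s1 s2 z"
    using ln_norm_deriv_has_derivative[OF der[OF hol(1) S(2)] der[OF hol(2) S(2)] nz(1)[OF S(2)]] by metis
  obtain E where E: "\<And>v. (ln_norm_deriv t1 t2 v has_derivative E v) (at z)"
    "E 1 1 + E \<i> \<i> = 4 * spherical_density t1 t2 z"
    using ln_norm_deriv_has_derivative[OF der[OF hol(3) S(2)] der[OF hol(4) S(2)] nz(2)[OF S(2)]] by metis
  have d2: "dirderiv v (dirderiv v (\<lambda>w. ln (metric_density X w))) z = D v v + E v v" for v
    by (rule dirderiv_eq_on_open[OF has_derivative_add[OF D(1) E(1)] S]) (simp add: d1 ld_def)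
  have "metric_density X z > 0"
    unfolding X[OF S(2)] by (intro mult_pos_pos pos nz S)
  then have "gauss_curvature X z * metric_density X z = - ((D 1 1 + D \<i> \<i>) + (E 1 1 + E \<i> \<i>)) / 2"
    by (simp add: gauss_curvature_def d2 field_simps)
  then show ?thesis unfolding D(2) E(2) by (simp add: field_simps)
qed

section \<open>Homogeneous Weierstrass data\<close>

text \<open>Weierstrass data are written homogeneously, \<open>g1 = s2 / s1\<close>, \<open>g2 = t2 / t1\<close> and \<open>h = s1 t1\<close>. In these
  terms the forms have no apparent singularities at the poles of \<open>g1\<close> and \<open>g2\<close>: they are, up to a
  linear isomorphism, the four products \<open>s\<^sub>i t\<^sub>j\<close>, the Segre parametrization of the null quadric
  \<open>\<phi>\<^sub>1\<^sup>2 + \<phi>\<^sub>2\<^sup>2 + \<phi>\<^sub>3\<^sup>2 + \<phi>\<^sub>4\<^sup>2 = 0\<close>.\<close>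

definition spinor_form ::
    "(complex \<Rightarrow> complex) \<Rightarrow> (complex \<Rightarrow> complex) \<Rightarrow> (complex \<Rightarrow> complex) \<Rightarrow> (complex \<Rightarrow> complex)
      \<Rightarrow> 4 \<Rightarrow> complex \<Rightarrow> complex"
  where "spinor_form s1 s2 t1 t2 k z = (vector
     [ 1 / 2 * (s1 z * t1 z + s2 z * t2 z),
       \<i> / 2 * (s1 z * t1 z - s2 z * t2 z),
       1 / 2 * (s2 z * t1 z - s1 z * t2 z),
       - (\<i> / 2) * (s2 z * t1 z + s1 z * t2 z) ] :: complex^4) $ k"

lemma vector_4 [simp]:
  "(vector [w, x, y, z] :: 'a::zero^4) $ 1 = w"
  "(vector [w, x, y, z] :: 'a::zero^4) $ 2 = x"
  "(vector [w, x, y, z] :: 'a::zero^4) $ 3 = y"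
  "(vector [w, x, y, z] :: 'a::zero^4) $ 4 = z"
  by (simp_all add: vector_def)

lemma spinor_form_isotropic: "(\<Sum>k\<in>UNIV. (spinor_form s1 s2 t1 t2 k z)\<^sup>2) = 0"
  by (simp add: sum_4 spinor_form_def power2_eq_square field_simps)

text \<open>The parallelogram law removes the mixed terms. The formula yields the induced metric, and it shows
  that the forms have no common zero if neither \<open>(s1, s2)\<close> nor \<open>(t1, t2)\<close> vanishes.\<close>

lemma sum_norm_spinor_form:
  "(\<Sum>k\<in>UNIV. (norm (spinor_form s1 s2 t1 t2 k z))\<^sup>2)
    = ((norm (s1 z))\<^sup>2 + (norm (s2 z))\<^sup>2) * ((norm (t1 z))\<^sup>2 + (norm (t2 z))\<^sup>2) / 2"
proof -
  have par: "(norm (x + y))\<^sup>2 + (norm (x - y))\<^sup>2 = 2 * (norm x)\<^sup>2 + 2 * (norm y)\<^sup>2" for x y :: complex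
    unfolding power2_norm_eq_inner by (simp add: algebra_simps)
  have "(\<Sum>k\<in>UNIV. (norm (spinor_form s1 s2 t1 t2 k z))\<^sup>2)
    = (((norm (s1 z * t1 z + s2 z * t2 z))\<^sup>2 + (norm (s1 z * t1 z - s2 z * t2 z))\<^sup>2)
      + ((norm (s2 z * t1 z + s1 z * t2 z))\<^sup>2 + (norm (s2 z * t1 z - s1 z * t2 z))\<^sup>2)) / 4"
    by (simp add: sum_4 spinor_form_def norm_mult norm_divide power_mult_distrib power_divide)
  also have "\<dots> = ((norm (s1 z))\<^sup>2 + (norm (s2 z))\<^sup>2) * ((norm (t1 z))\<^sup>2 + (norm (t2 z))\<^sup>2) / 2"
    unfolding par by (simp add: norm_mult power_mult_distrib field_simps)
  finally show ?thesis .
qed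

lemma spinor_form_nonzero:
  assumes "s1 z \<noteq> 0 \<or> s2 z \<noteq> 0" "t1 z \<noteq> 0 \<or> t2 z \<noteq> 0"
  shows "\<exists>k. spinor_form s1 s2 t1 t2 k z \<noteq> 0"
proof (rule ccontr)
  assume "\<nexists>k. spinor_form s1 s2 t1 t2 k z \<noteq> 0"
  then have "((norm (s1 z))\<^sup>2 + (norm (s2 z))\<^sup>2) * ((norm (t1 z))\<^sup>2 + (norm (t2 z))\<^sup>2) = 0"
    using sum_norm_spinor_form[of s1 s2 t1 t2 z] by simp
  then have "s1 z = 0 \<and> s2 z = 0 \<or> t1 z = 0 \<and> t2 z = 0"
    by (simp add: sum_power2_eq_zero_iff)
  with assms show False by blast
qed

lemma spinor_form_primitive:
  assumes "(P11 has_field_derivative s1 z * t1 z) (at z)" "(P12 has_field_derivative s1 z * t2 z) (at z)"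
    "(P21 has_field_derivative s2 z * t1 z) (at z)" "(P22 has_field_derivative s2 z * t2 z) (at z)"
  shows "((\<lambda>z. (vector [ P11 z + P22 z, \<i> * (P11 z - P22 z), P21 z - P12 z, - \<i> * (P21 z + P12 z) ]
      :: complex^4) $ k) has_field_derivative 2 * spinor_form s1 s2 t1 t2 k z) (at z)"
  using exhaust_4[of k]
  by (elim disjE) (auto intro!: derivative_eq_intros assms simp: spinor_form_def algebra_simps)

text \<open>The poles of \<open>g1\<close> and \<open>g2\<close> are isolated zeros of \<open>s1\<close> and \<open>t1\<close>, and the continuous homogeneous
  form supplies the limit there; so the two forms agree even where the quotients are meaningless.\<close>

lemma weierstrass_form_eq_spinor_form:
  assumes ev: "\<forall>\<^sub>F w in at z. s1 w \<noteq> 0 \<and> t1 w \<noteq> 0 \<and> g1 w = s2 w / s1 w \<and> g2 w = t2 w / t1 w \<and> h w = s1 w * t1 w"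
    and cont: "isCont (spinor_form s1 s2 t1 t2 k) z"
  shows "weierstrass_form g1 g2 h k z = spinor_form s1 s2 t1 t2 k z"
  unfolding weierstrass_form_def
proof (rule remove_sings_eqI, rule Lim_transform_eventually)
  show "((spinor_form s1 s2 t1 t2 k) \<longlongrightarrow> spinor_form s1 s2 t1 t2 k z) (at z)"
    using cont by (simp add: isCont_def)
  show "\<forall>\<^sub>F w in at z. spinor_form s1 s2 t1 t2 k w = (vector
     [ 1 / 2 * (1 + g1 w * g2 w) * h w,
       \<i> / 2 * (1 - g1 w * g2 w) * h w,
       1 / 2 * (g1 w - g2 w) * h w,
       - (\<i> / 2) * (g1 w + g2 w) * h w ] :: complex^4) $ k"
    using ev
  proof eventually_elim
    case (elim w)
    then show ?case
      using exhaust_4[of k] by (elim disjE) (auto simp: spinor_form_def field_simps)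
  qed
qed

text \<open>A single-valued primitive of the forms makes all their periods vanish, and not only the real parts
  of the periods.\<close>

lemma weierstrass_data_re_vec:
  assumes S: "open S" "S \<noteq> {}"
    and g: "g1 meromorphic_on S" "g2 meromorphic_on S" "h holomorphic_on S"
    and nz: "\<And>z. z \<in> S \<Longrightarrow> \<exists>k. weierstrass_form g1 g2 h k z \<noteq> 0"
    and G: "\<And>k z. z \<in> S \<Longrightarrow> (G k has_field_derivative 2 * weierstrass_form g1 g2 h k z) (at z)"
  shows "weierstrass_data S g1 g2 h (re_vec G)"
proof -
  let ?\<phi> = "weierstrass_form g1 g2 h"
  have hol: "?\<phi> k holomorphic_on S" for k
    by (rule holomorphic_on_derivative[OF S(1) G]) auto
  have int: "((\<lambda>z. 2 * ?\<phi> k z) has_contour_integral G k (pathfinish c) - G k (pathstart c)) c"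
    if "valid_path c" "path_image c \<subseteq> S" for c k
    by (rule contour_integral_primitive[OF _ that]) (rule DERIV_subset[OF G], auto)
  have period: "Re (contour_integral c (?\<phi> k)) = 0"
    if c: "valid_path c" "path_image c \<subseteq> S" "pathfinish c = pathstart c" for c k
  proof -
    have "((\<lambda>z. 1 / 2 * (2 * ?\<phi> k z)) has_contour_integral 1 / 2 * (G k (pathfinish c) - G k (pathstart c))) c"
      by (rule has_contour_integral_lmul[OF int[OF c(1,2)]])
    then show ?thesis
      using c(3) by (simp add: contour_integral_unique)
  qed
  obtain z0 where "z0 \<in> S" using S(2) by blast
  have "re_vec G (pathfinish c) $ k
      = re_vec G z0 $ k + Re (contour_integral c (\<lambda>z. 2 * ?\<phi> k z))"
    if "valid_path c" "path_image c \<subseteq> S" "pathstart c = z0" for c k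
    using contour_integral_unique[OF int[OF that(1,2), of k]] that(3) by (simp add: re_vec_def)
  then show ?thesis
    unfolding weierstrass_data_def using g nz hol period \<open>z0 \<in> S\<close> by blast
qed

section \<open>Estimates and primitives for the power data\<close>

text \<open>Both \<open>\<alpha> - 1\<close> and \<open>(\<alpha> - 1) w\<close> are linear combinations of \<open>w - 1\<close> and \<open>w - \<alpha>\<close>, so the Cauchy-Schwarz
  inequality bounds \<open>1\<close> and \<open>|w|\<^sup>2\<close> by \<open>|w - 1|\<^sup>2 + |w - \<alpha>|\<^sup>2\<close>.\<close>

lemma norm_sub_one_sub_bound:
  fixes \<alpha> w :: complex
  shows "(norm (\<alpha> - 1))\<^sup>2 * (1 + (norm w)\<^sup>2) \<le> ((norm \<alpha>)\<^sup>2 + 3) * ((norm (w - 1))\<^sup>2 + (norm (w - \<alpha>))\<^sup>2)"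
proof -
  let ?x = "norm (w - 1)" and ?y = "norm (w - \<alpha>)" and ?A = "norm \<alpha>"
  have "norm (\<alpha> - 1) = norm ((w - 1) - (w - \<alpha>))" by simp
  also have "\<dots> \<le> ?x + ?y" by (rule norm_triangle_ineq4)
  finally have "(norm (\<alpha> - 1))\<^sup>2 \<le> (?x + ?y)\<^sup>2" by (intro power_mono) auto
  also have "\<dots> \<le> 2 * (?x\<^sup>2 + ?y\<^sup>2)" using sum_squares_bound[of ?x ?y] by (simp add: power2_sum)
  finally have 1: "(norm (\<alpha> - 1))\<^sup>2 \<le> 2 * (?x\<^sup>2 + ?y\<^sup>2)" .
  have "norm (\<alpha> - 1) * norm w = norm (\<alpha> * (w - 1) - (w - \<alpha>))"
    unfolding norm_mult[symmetric] by (simp add: algebra_simps)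
  also have "\<dots> \<le> ?A * ?x + ?y" unfolding norm_mult[symmetric] by (rule norm_triangle_ineq4)
  finally have "(norm (\<alpha> - 1) * norm w)\<^sup>2 \<le> (?A * ?x + ?y)\<^sup>2" by (intro power_mono) auto
  also have "\<dots> = (?A\<^sup>2 + 1) * (?x\<^sup>2 + ?y\<^sup>2) - (?x - ?A * ?y)\<^sup>2"
    by (simp add: power2_eq_square algebra_simps)
  also have "\<dots> \<le> (?A\<^sup>2 + 1) * (?x\<^sup>2 + ?y\<^sup>2)" by simp
  finally have 2: "(norm (\<alpha> - 1))\<^sup>2 * (norm w)\<^sup>2 \<le> (?A\<^sup>2 + 1) * (?x\<^sup>2 + ?y\<^sup>2)"
    by (simp add: power_mult_distrib)
  from 1 2 show ?thesis by (simp add: algebra_simps)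
qed

lemma norm_sub_one_sub_lower:
  assumes "\<alpha> \<noteq> (1::complex)"
  obtains c where "c > 0" "\<And>w. c * (1 + (norm w)\<^sup>2) \<le> (norm (w - 1))\<^sup>2 + (norm (w - \<alpha>))\<^sup>2"
proof
  let ?K = "(norm \<alpha>)\<^sup>2 + 3"
  have K: "?K > 0" by (intro add_nonneg_pos) auto
  show "(norm (\<alpha> - 1))\<^sup>2 / ?K > 0" using assms K by simp
  show "(norm (\<alpha> - 1))\<^sup>2 / ?K * (1 + (norm w)\<^sup>2) \<le> (norm (w - 1))\<^sup>2 + (norm (w - \<alpha>))\<^sup>2" for w
    using norm_sub_one_sub_bound[of \<alpha> w] K by (simp add: pos_divide_le_eq mult.commute)
qed

text \<open>Near the origin the right-hand side grows like \<open>1 / r ^ (2 l)\<close> and near infinity like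
  \<open>r ^ (2 (m + n - l))\<close>; the hypotheses on \<open>l\<close>, \<open>m\<close>, \<open>n\<close> say that either exponent is good enough for a
  cylindrical end.\<close>

lemma inverse_square_le_power_bound:
  fixes r :: real
  assumes "r > 0" "m + n \<ge> l" "l > 0"
  shows "1 / r\<^sup>2 \<le> (1 + (r ^ m)\<^sup>2) * (1 + (r ^ n)\<^sup>2) / (r ^ l)\<^sup>2"
proof -
  have "(r ^ l)\<^sup>2 \<le> r\<^sup>2 * (1 + (r ^ (m + n))\<^sup>2)"
  proof (cases "r \<le> 1")
    case True
    then have "r ^ l \<le> r ^ 1" using assms by (intro power_decreasing) auto
    then have "(r ^ l)\<^sup>2 \<le> r\<^sup>2 * 1" using power_mono[of "r ^ l" r 2] assms by simp
    also have "\<dots> \<le> r\<^sup>2 * (1 + (r ^ (m + n))\<^sup>2)" by (intro mult_left_mono) auto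
    finally show ?thesis .
  next
    case False
    then have "r ^ l \<le> r ^ (m + n + 1)" using assms by (intro power_increasing) auto
    then have "(r ^ l)\<^sup>2 \<le> (r * r ^ (m + n))\<^sup>2" using assms by (intro power_mono) auto
    also have "\<dots> \<le> r\<^sup>2 * (1 + (r ^ (m + n))\<^sup>2)"
      by (simp add: power_mult_distrib distrib_left)
    finally show ?thesis .
  qed
  also have "\<dots> \<le> r\<^sup>2 * ((1 + (r ^ m)\<^sup>2) * (1 + (r ^ n)\<^sup>2))"
    by (intro mult_left_mono) (simp_all add: algebra_simps power_add power_mult_distrib)
  finally show ?thesis using assms(1) by (simp add: field_simps)
qed

text \<open>The hypotheses say that none of the four exponents in the Laurent polynomial is \<open>-1\<close>, so that its
  residue at the origin vanishes for all \<open>\<alpha>\<close> and \<open>\<beta>\<close>.\<close>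

lemma laurent_primitive:
  assumes "int m + int n - int l \<noteq> -1" "int m - int l \<noteq> -1" "int n - int l \<noteq> -1" "l \<noteq> 1"
  obtains P where
    "\<And>\<alpha> \<beta> z :: complex. z \<noteq> 0 \<Longrightarrow>
      (P \<alpha> \<beta> has_field_derivative (z ^ m - \<alpha>) * (z ^ n - \<beta>) / z ^ l) (at z)"
proof
  define I where "I k z = z powi (k + 1) / of_int (k + 1)" for k and z :: complex
  have I: "(I k has_field_derivative z powi k) (at z)" if "k \<noteq> -1" "z \<noteq> 0" for k z
  proof -
    have "of_int (k + 1) \<noteq> (0::complex)" using that(1) by (simp only: of_int_eq_0_iff)
    with that(2) show ?thesis
      unfolding I_def by (auto intro!: derivative_eq_intros simp del: of_int_add)
  qed
  fix \<alpha> \<beta> z :: complex assume z: "z \<noteq> 0"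
  have eq: "(z ^ m - \<alpha>) * (z ^ n - \<beta>) / z ^ l = z powi (int m + int n - int l) - \<beta> * z powi (int m - int l)
      - \<alpha> * z powi (int n - int l) + \<alpha> * \<beta> * z powi (- int l)"
    using z by (simp add: power_int_diff power_int_add power_int_minus field_simps)
  have "- int l \<noteq> -1" using assms(4) by simp
  note d = I[OF assms(1) z] I[OF assms(2) z] I[OF assms(3) z] I[OF this z]
  show "((\<lambda>\<alpha> \<beta> z. I (int m + int n - int l) z - \<beta> * I (int m - int l) z
      - \<alpha> * I (int n - int l) z + \<alpha> * \<beta> * I (- int l) z) \<alpha> \<beta>
      has_field_derivative (z ^ m - \<alpha>) * (z ^ n - \<beta>) / z ^ l) (at z)"
    unfolding eq by (intro DERIV_add DERIV_diff DERIV_cmult d)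
qed

section \<open>Integrability of the spherical density\<close>

text \<open>The density of the round sphere in the stereographic chart. It is dominated by the product
  \<open>1 / ((1 + x\<^sup>2) (1 + y\<^sup>2))\<close>, and the integral of that product factors.\<close>

lemma integrable_inverse_1_plus_norm_square_square:
  "integrable lborel (\<lambda>z::complex. 1 / (1 + (norm z)\<^sup>2)\<^sup>2)"
proof (rule integrableI_bounded)
  have "set_integrable lborel (einterval (- \<infinity>) \<infinity>) (\<lambda>x::real. inverse (1 + x\<^sup>2))"
    by (rule integrable_inverse_1_plus_square)
  then have int: "integrable lborel (\<lambda>x::real. inverse (1 + x\<^sup>2))"
    by (simp add: set_integrable_def)
  then have fin: "(\<integral>\<^sup>+(x::real). ennreal (inverse (1 + x\<^sup>2)) \<partial>lborel) < \<infinity>"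
    unfolding integrable_iff_bounded by simp
  have "(\<integral>\<^sup>+(z::complex). ennreal (norm (1 / (1 + (norm z)\<^sup>2)\<^sup>2)) \<partial>lborel)
     \<le> (\<integral>\<^sup>+(z::complex). (\<Prod>b\<in>Basis. ennreal (inverse (1 + (z \<bullet> b)\<^sup>2))) \<partial>lborel)"
  proof (rule nn_integral_mono)
    fix z :: complex
    have "(1 + (Re z)\<^sup>2) * (1 + (Im z)\<^sup>2) \<le> (1 + (norm z)\<^sup>2)\<^sup>2"
    proof -
      have "(1 + (norm z)\<^sup>2)\<^sup>2 - (1 + (Re z)\<^sup>2) * (1 + (Im z)\<^sup>2)
          = (norm z)\<^sup>2 + (Re z)^4 + (Re z)\<^sup>2 * (Im z)\<^sup>2 + (Im z)^4"
        unfolding cmod_power2 by (simp add: power2_eq_square power4_eq_xxxx algebra_simps)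
      also have "\<dots> \<ge> 0" by simp
      finally show ?thesis by simp
    qed
    moreover have "0 < (1 + (Re z)\<^sup>2) * (1 + (Im z)\<^sup>2)"
      by (intro mult_pos_pos add_pos_nonneg) auto
    ultimately have "norm (1 / (1 + (norm z)\<^sup>2)\<^sup>2) \<le> inverse (1 + (Re z)\<^sup>2) * inverse (1 + (Im z)\<^sup>2)"
      using le_imp_inverse_le by (fastforce simp: divide_inverse)
    then show "ennreal (norm (1 / (1 + (norm z)\<^sup>2)\<^sup>2)) \<le> (\<Prod>b\<in>Basis. ennreal (inverse (1 + (z \<bullet> b)\<^sup>2)))"
      by (simp add: Basis_complex_def inner_complex_def ennreal_mult[symmetric] ennreal_leI)
  qed
  also have "\<dots> = (\<Prod>b\<in>(Basis::complex set). (\<integral>\<^sup>+(x::real). ennreal (inverse (1 + x\<^sup>2)) \<partial>lborel))"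
    by (rule nn_integral_lborel_prod) auto
  also have "\<dots> < \<infinity>"
    using fin by (simp add: Basis_complex_def ennreal_mult_less_top)
  finally show "(\<integral>\<^sup>+(z::complex). ennreal (norm (1 / (1 + (norm z)\<^sup>2)\<^sup>2)) \<partial>lborel) < \<infinity>" .
qed simp

text \<open>The density depends only on the point \<open>[f z : g z]\<close> of the projective line: the common factor \<open>u\<close>
  enters the Wronskian and the sum of squares as \<open>u\<^sup>2\<close> and \<open>|u|\<^sup>2\<close>.\<close>

lemma spherical_density_mult:
  assumes "u field_differentiable at z" "f field_differentiable at z" "g field_differentiable at z" "u z \<noteq> 0"
  shows "spherical_density (\<lambda>w. u w * f w) (\<lambda>w. u w * g w) z = spherical_density f g z"
proof -
  have "u z * f z * deriv (\<lambda>w. u w * g w) z - u z * g z * deriv (\<lambda>w. u w * f w) z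
      = (u z)\<^sup>2 * (f z * deriv g z - g z * deriv f z)"
    using assms by (simp add: power2_eq_square algebra_simps)
  moreover have "(norm (u z * f z))\<^sup>2 + (norm (u z * g z))\<^sup>2 = (norm (u z))\<^sup>2 * ((norm (f z))\<^sup>2 + (norm (g z))\<^sup>2)"
    by (simp add: norm_mult power_mult_distrib distrib_left)
  ultimately show ?thesis
    using assms(4) by (simp add: spherical_density_def norm_mult norm_power power_mult_distrib)
qed

lemma spherical_density_power:
  "spherical_density (\<lambda>z. z ^ m - 1) (\<lambda>z. z ^ m - \<alpha>) z =
    (norm ((\<alpha> - 1) * of_nat m * z ^ (m - 1)))\<^sup>2 / ((norm (z ^ m - 1))\<^sup>2 + (norm (z ^ m - \<alpha>))\<^sup>2)\<^sup>2"
proof -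
  have "deriv (\<lambda>z. z ^ m - c) z = of_nat m * z ^ (m - 1)" for c :: complex
    by (rule DERIV_imp_deriv) (auto intro!: derivative_eq_intros)
  then have "(z ^ m - 1) * deriv (\<lambda>z. z ^ m - \<alpha>) z - (z ^ m - \<alpha>) * deriv (\<lambda>z. z ^ m - 1) z
      = (\<alpha> - 1) * of_nat m * z ^ (m - 1)"
    by (simp add: algebra_simps)
  then show ?thesis by (simp add: spherical_density_def)
qed

lemma power_pred_mult_le:
  fixes r :: real
  assumes "r \<ge> 0" "m > 0"
  shows "r ^ (m - 1) * (1 + r\<^sup>2) \<le> 2 * (1 + r ^ (2 * m))"
proof (cases "r \<le> 1")
  case True
  have "r ^ (m - 1) * (1 + r\<^sup>2) \<le> 1 * (1 + 1)"
    using True assms by (intro mult_mono add_mono) (auto simp: power_le_one)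
  also have "\<dots> \<le> 2 * (1 + r ^ (2 * m))" using assms by simp
  finally show ?thesis .
next
  case False
  then have "r ^ (m - 1) * (1 + r\<^sup>2) \<le> r ^ (m - 1) * (2 * r\<^sup>2)"
    by (intro mult_left_mono) auto
  also have "\<dots> = 2 * r ^ (m + 1)"
    using assms by (simp add: power_add[symmetric])
  also have "\<dots> \<le> 2 * r ^ (2 * m)"
    using False assms by (intro mult_left_mono power_increasing) auto
  finally show ?thesis by simp
qed

text \<open>The map \<open>z \<mapsto> [z ^ m - 1 : z ^ m - \<alpha>]\<close> extends to a rational map of the sphere, so its spherical
  density is at most a multiple of \<open>1 / (1 + |z|\<^sup>2)\<^sup>2\<close>, the density of the sphere itself.\<close>

lemma integrable_spherical_density_power:
  assumes m: "m > 0" and \<alpha>: "\<alpha> \<noteq> 1"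
  shows "integrable lborel (spherical_density (\<lambda>z. z ^ m - 1) (\<lambda>z. z ^ m - \<alpha>))"
proof -
  obtain c where c: "c > 0" "\<And>w. c * (1 + (norm w)\<^sup>2) \<le> (norm (w - 1))\<^sup>2 + (norm (w - \<alpha>))\<^sup>2"
    using norm_sub_one_sub_lower[OF \<alpha>] by blast
  let ?A = "\<lambda>z::complex. (norm (z ^ m - 1))\<^sup>2 + (norm (z ^ m - \<alpha>))\<^sup>2"
  let ?f = "\<lambda>z. (norm ((\<alpha> - 1) * of_nat m * z ^ (m - 1)))\<^sup>2 / (?A z)\<^sup>2"
  have A: "?A z > 0" for z
    using c(2)[of "z ^ m"] c(1) by (smt (verit) mult_pos_pos zero_le_power2)
  define K where "K = (2 * norm ((\<alpha> - 1) * of_nat m) / c)\<^sup>2"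
  have bound: "?f z \<le> K * (1 / (1 + (norm z)\<^sup>2)\<^sup>2)" for z
  proof -
    let ?r = "norm z"
    have p: "1 + ?r\<^sup>2 > 0" by (intro add_pos_nonneg) auto
    have quot: "x / y \<le> 2 / c * (1 / p)" if "c * (x * p) \<le> 2 * y" "y > 0" "p > 0" for x y p
      using that c(1) by (simp add: field_simps)
    have "c * (?r ^ (m - 1) * (1 + ?r\<^sup>2)) \<le> 2 * (c * (1 + (norm (z ^ m))\<^sup>2))"
      using power_pred_mult_le[of ?r m] m c(1) by (simp add: norm_power power_mult[symmetric] mult.commute)
    also have "\<dots> \<le> 2 * ?A z" using c(2)[of "z ^ m"] by simp
    finally have "?r ^ (m - 1) / ?A z \<le> 2 / c * (1 / (1 + ?r\<^sup>2))"
      using quot A[of z] c(1) p by blast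
    then have "norm ((\<alpha> - 1) * of_nat m) * (?r ^ (m - 1) / ?A z) \<le> norm ((\<alpha> - 1) * of_nat m) * (2 / c * (1 / (1 + ?r\<^sup>2)))"
      by (rule mult_left_mono) simp
    then have "(norm ((\<alpha> - 1) * of_nat m) * (?r ^ (m - 1) / ?A z))\<^sup>2 \<le> (norm ((\<alpha> - 1) * of_nat m) * (2 / c * (1 / (1 + ?r\<^sup>2))))\<^sup>2"
      using A[of z] by (intro power_mono) auto
    then show ?thesis
      by (simp add: K_def norm_mult norm_power power_mult_distrib power_divide mult_ac)
  qed
  have "continuous_on UNIV ?f"
    using A by (intro continuous_intros) (metis less_irrefl power_eq_0_iff)
  then have meas: "?f \<in> borel_measurable lborel"
    by (simp add: borel_measurable_continuous_onI)
  have "integrable lborel ?f"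
    by (rule Bochner_Integration.integrable_bound[OF integrable_mult_right[OF integrable_inverse_1_plus_norm_square_square, of K] meas])
      (use bound in \<open>auto simp: K_def\<close>)
  then show ?thesis by (simp add: spherical_density_power[abs_def])
qed

section \<open>Omitted values and the surface\<close>

lemma eventually_power_neq_one:
  fixes z :: complex
  assumes "m > 0"
  shows "\<forall>\<^sub>F w in at z. w ^ m \<noteq> 1"
proof -
  have "finite {w::complex. w ^ m = 1}" using assms by (intro finite_roots_unity) auto
  then show ?thesis
    using islimpt_finite[of "{w. w ^ m = 1}" z] by (simp add: islimpt_iff_eventually)
qed

text \<open>The quotient is \<open>w \<mapsto> (w - \<alpha>) / (w - 1)\<close>, a Moebius transformation, applied to \<open>w = z ^ m\<close>. It takes the
  values \<open>1\<close> and \<open>\<alpha>\<close> only at \<open>w = \<infinity>\<close> and \<open>w = 0\<close>, which correspond to the two punctures.\<close>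

lemma omits_power_quotient:
  fixes \<alpha> :: complex
  assumes m: "m > 0" and \<alpha>: "\<alpha> \<noteq> 1"
  shows "omits (- {0}) (\<lambda>z. (z ^ m - \<alpha>) / (z ^ m - 1)) (Some 1)"
    and "omits (- {0}) (\<lambda>z. (z ^ m - \<alpha>) / (z ^ m - 1)) (Some \<alpha>)"
proof -
  let ?g = "\<lambda>z. (z ^ m - \<alpha>) / (z ^ m - 1)"
  have "sphere_value ?g z \<noteq> Some 1 \<and> sphere_value ?g z \<noteq> Some \<alpha>" if z: "z \<noteq> 0" for z
  proof (cases "z ^ m = 1")
    case True
    have "filterlim (\<lambda>z. z ^ m - 1) (nhds 0) (at z)"
      using True by (auto intro!: tendsto_eq_intros)
    then have "filterlim (\<lambda>z. z ^ m - 1) (at 0) (at z)"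
      using eventually_power_neq_one[OF m, of z] by (simp add: filterlim_at)
    then have "is_pole ?g z"
      using True \<alpha> by (intro is_pole_divide) auto
    then show ?thesis by (simp add: sphere_value_def)
  next
    case False
    have "?g analytic_on {z}" using False by (intro analytic_intros) auto
    moreover have "?g z \<noteq> 1" using False \<alpha> by (simp add: divide_eq_1_iff)
    moreover have "?g z \<noteq> \<alpha>"
    proof
      assume "?g z = \<alpha>"
      then have "z ^ m - \<alpha> = \<alpha> * (z ^ m - 1)" using False by (simp add: divide_eq_eq)
      then have "z ^ m * (1 - \<alpha>) = 0" by (simp add: algebra_simps)
      with z \<alpha> show False by simp
    qed
    ultimately show ?thesis
      by (simp add: sphere_value_def)
  qed
  then show "omits (- {0}) ?g (Some 1)" "omits (- {0}) ?g (Some \<alpha>)"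
    by (auto simp: omits_def)
qed

theorem theorem4p12:
  fixes S :: "complex set" and a b :: real and l m n :: nat
    and g1 g2 h :: "complex \<Rightarrow> complex"
  assumes "S = finite_points (UNIV - {Some 0, sphere_inf})"
    and "a \<notin> {0, 1}" and "b \<notin> {0, 1}"
    and "l > 0" and "m > 0" and "n > 0"
    and "int m + int n > 2 * int l - 2" and "2 * int l - 2 \<ge> 2"
    and "int m - int l \<noteq> -1" and "int n - int l \<noteq> -1"
    and "g1 = (\<lambda>z. (z ^ m - of_real a) / (z ^ m - 1))"
    and "g2 = (\<lambda>z. (z ^ n - of_real b) / (z ^ n - 1))"
    and "h = (\<lambda>z. (z ^ m - 1) * (z ^ n - 1) / z ^ l)"
  shows "\<exists>X :: complex \<Rightarrow> real^4.
    minimal_surface S X \<and> complete_surface S X \<and> weierstrass_data S g1 g2 h X \<and>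
    finite_total_curvature S X \<and>
    omits S g1 (Some 1) \<and> omits S g1 (Some (of_real a)) \<and>
    omits S g2 (Some 1) \<and> omits S g2 (Some (of_real b))"
proof -
  define \<alpha> \<beta> where "\<alpha> = complex_of_real a" and "\<beta> = complex_of_real b"
  have ne: "\<alpha> \<noteq> 1" "\<beta> \<noteq> 1"
    using assms(2,3) by (auto simp: \<alpha>_def \<beta>_def)
  have S: "S = - {0}"
    unfolding assms(1) finite_points_def by auto
  have topS: "open S" "connected S" "S \<noteq> {}"
    using connected_punctured_universe[of "0::complex"] by (auto simp: S Compl_eq_Diff_UNIV open_delete)
  have in_S: "z \<in> S \<longleftrightarrow> z \<noteq> 0" for z by (simp add: S)
  define u where "u z = 1 / z ^ l" for z :: complex
  (* the factor 1 / z ^ l of h goes to the first pair, so that s1 * t1 = h *)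
  define s1 s2 t1 t2 where "s1 z = u z * (z ^ m - 1)" and "s2 z = u z * (z ^ m - \<alpha>)"
    and "t1 z = z ^ n - 1" and "t2 z = z ^ n - \<beta>" for z
  have hol: "u holomorphic_on S" "s1 holomorphic_on S" "s2 holomorphic_on S" "t1 holomorphic_on S" "t2 holomorphic_on S"
    unfolding s1_def[abs_def] s2_def[abs_def] t1_def[abs_def] t2_def[abs_def] u_def[abs_def]
    by (intro holomorphic_intros; simp add: S)+
  have s_nz: "s1 z \<noteq> 0 \<or> s2 z \<noteq> 0" if "z \<in> S" for z
    using that ne by (auto simp: in_S s1_def s2_def u_def)
  have t_nz: "t1 z \<noteq> 0 \<or> t2 z \<noteq> 0" for z
    using ne by (auto simp: t1_def t2_def)
  have ex: "int m + int n - int l \<noteq> -1" "l \<noteq> 1" using assms(7,8) by linarith+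
  obtain P :: "complex \<Rightarrow> complex \<Rightarrow> complex \<Rightarrow> complex" where P: "\<And>\<gamma> \<delta> z. z \<noteq> 0 \<Longrightarrow>
      (P \<gamma> \<delta> has_field_derivative (z ^ m - \<gamma>) * (z ^ n - \<delta>) / z ^ l) (at z)"
    by (rule laurent_primitive[OF ex(1) assms(9,10) ex(2)]) (rule that)
  (* the products s1 t1, s1 t2, s2 t1, s2 t2 have the primitives P 1 1, P 1 \<beta>, P \<alpha> 1, P \<alpha> \<beta> *)
  define G :: "4 \<Rightarrow> complex \<Rightarrow> complex" where "G k z = (vector [ P 1 1 z + P \<alpha> \<beta> z, \<i> * (P 1 1 z - P \<alpha> \<beta> z),
      P \<alpha> 1 z - P 1 \<beta> z, - \<i> * (P \<alpha> 1 z + P 1 \<beta> z) ] :: complex^4) $ k" for k z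
  let ?\<phi> = "spinor_form s1 s2 t1 t2"
  have G: "(G k has_field_derivative 2 * ?\<phi> k z) (at z)" if "z \<in> S" for k z
    unfolding G_def[abs_def]
    by (rule spinor_form_primitive)
      (use P[of z] that in \<open>auto simp: in_S s1_def s2_def t1_def t2_def u_def\<close>)
  have iso: "(\<Sum>k\<in>UNIV. (2 * ?\<phi> k z)\<^sup>2) = 0" for z
    by (simp add: power_mult_distrib sum_distrib_left[symmetric] spinor_form_isotropic)
  have nz: "\<exists>k. ?\<phi> k z \<noteq> 0" if "z \<in> S" for z
    by (rule spinor_form_nonzero) (use s_nz[OF that] t_nz[of z] in auto)
  have density: "metric_density (re_vec G) z =
      ((norm (s1 z))\<^sup>2 + (norm (s2 z))\<^sup>2) * ((norm (t1 z))\<^sup>2 + (norm (t2 z))\<^sup>2)" if "z \<in> S" for z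
    using metric_density_re_vec[OF G[OF that] iso] sum_norm_spinor_form[of s1 s2 t1 t2 z]
    by (simp add: norm_mult power_mult_distrib sum_distrib_left[symmetric])

  have "minimal_surface S (re_vec G)"
    using nz by (intro minimal_surface_re_vec[OF topS G iso]) auto

  moreover have "complete_surface S (re_vec G)"
  proof -
    obtain c where c: "c > 0" "\<And>w. c * (1 + (norm w)\<^sup>2) \<le> (norm (w - 1))\<^sup>2 + (norm (w - \<alpha>))\<^sup>2"
      using norm_sub_one_sub_lower[OF ne(1)] by blast
    obtain d where d: "d > 0" "\<And>w. d * (1 + (norm w)\<^sup>2) \<le> (norm (w - 1))\<^sup>2 + (norm (w - \<beta>))\<^sup>2"
      using norm_sub_one_sub_lower[OF ne(2)] by blast
    have bound: "sqrt (c * d) / norm z \<le> sqrt (metric_density (re_vec G) z)" if z: "z \<noteq> 0" for z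
    proof -
      let ?r = "norm z"
      have "c * d / ?r\<^sup>2 \<le> c * d * ((1 + (?r ^ m)\<^sup>2) * (1 + (?r ^ n)\<^sup>2) / (?r ^ l)\<^sup>2)"
        using mult_left_mono[OF inverse_square_le_power_bound[of ?r l m n], of "c * d"] z c(1) d(1) assms(4,7,8)
        by simp
      also have "\<dots> = (c * (1 + (norm (z ^ m))\<^sup>2)) * (d * (1 + (norm (z ^ n))\<^sup>2)) / (?r ^ l)\<^sup>2"
        by (simp add: norm_power)
      also have "\<dots> \<le> ((norm (z ^ m - 1))\<^sup>2 + (norm (z ^ m - \<alpha>))\<^sup>2) *
          ((norm (z ^ n - 1))\<^sup>2 + (norm (z ^ n - \<beta>))\<^sup>2) / (?r ^ l)\<^sup>2"
        using c d by (intro divide_right_mono mult_mono) auto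
      also have "\<dots> = metric_density (re_vec G) z"
        using z by (simp add: density in_S s1_def s2_def t1_def t2_def u_def norm_mult norm_divide
            norm_power power_divide field_simps)
      finally have "sqrt (c * d / ?r\<^sup>2) \<le> sqrt (metric_density (re_vec G) z)"
        by (rule real_sqrt_le_mono)
      then show ?thesis by (simp add: real_sqrt_divide)
    qed
    have "sqrt (c * d) > 0" using c(1) d(1) by simp
    then show ?thesis
      unfolding S using bound by (rule complete_punctured_plane)
  qed

  moreover have "weierstrass_data S g1 g2 h (re_vec G)"
  proof -
    have \<phi>: "weierstrass_form g1 g2 h k z = ?\<phi> k z" if z: "z \<in> S" for k z
    proof (rule weierstrass_form_eq_spinor_form)
      (* at the roots of unity g1 or g2 has a pole, but these points are isolated *)
      have "\<forall>\<^sub>F w in at z. w ^ m \<noteq> 1 \<and> w ^ n \<noteq> 1 \<and> w \<in> S"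
        using eventually_power_neq_one[OF assms(5)] eventually_power_neq_one[OF assms(6)]
          eventually_at_in_open'[OF topS(1) z] by eventually_elim auto
      then show "\<forall>\<^sub>F w in at z. s1 w \<noteq> 0 \<and> t1 w \<noteq> 0 \<and> g1 w = s2 w / s1 w \<and> g2 w = t2 w / t1 w \<and> h w = s1 w * t1 w"
        by eventually_elim
          (auto simp: in_S s1_def s2_def t1_def t2_def u_def assms(11-13) \<alpha>_def \<beta>_def)
      have "?\<phi> k holomorphic_on S"
        by (rule holomorphic_on_derivative[OF topS(1) G]) auto
      then show "isCont (?\<phi> k) z"
        using z topS(1) holomorphic_on_imp_continuous_on continuous_on_eq_continuous_at by blast
    qed
    show ?thesis
    proof (rule weierstrass_data_re_vec[OF topS(1,3)])
      show "g1 meromorphic_on S" "g2 meromorphic_on S"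
        unfolding assms(11,12) by (intro meromorphic_intros)+
      show "h holomorphic_on S"
        unfolding assms(13) by (intro holomorphic_intros) (simp add: S)
    qed (use \<phi> nz G in auto)
  qed

  moreover have "finite_total_curvature S (re_vec G)"
  proof -
    let ?F = "\<lambda>z. - 2 * (spherical_density (\<lambda>z. z ^ m - 1) (\<lambda>z. z ^ m - \<alpha>) z
      + spherical_density (\<lambda>z. z ^ n - 1) (\<lambda>z. z ^ n - \<beta>) z)"
    have eq: "gauss_curvature (re_vec G) z * metric_density (re_vec G) z = ?F z" if z: "z \<in> S" for z
    proof -
      have "gauss_curvature (re_vec G) z * metric_density (re_vec G) z
          = - 2 * (spherical_density s1 s2 z + spherical_density t1 t2 z)"
        by (rule gauss_curvature_mult_density[OF topS(1) z hol(2-5)]) (use s_nz t_nz density in auto)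
      moreover have "spherical_density s1 s2 z = spherical_density (\<lambda>z. z ^ m - 1) (\<lambda>z. z ^ m - \<alpha>) z"
        unfolding s1_def[abs_def] s2_def[abs_def]
      proof (rule spherical_density_mult)
        show "u field_differentiable at z"
          using hol(1) z topS(1) holomorphic_on_imp_differentiable_at by blast
        show "u z \<noteq> 0" using z by (simp add: u_def in_S)
      qed (intro derivative_intros)+
      ultimately show ?thesis
        by (simp add: t1_def[abs_def] t2_def[abs_def])
    qed
    have "integrable lborel ?F"
      by (intro integrable_mult_right Bochner_Integration.integrable_add
          integrable_spherical_density_power assms(5,6) ne)
    then have "set_integrable lborel S ?F"
      unfolding set_integrable_def using topS(1)
      by (intro integrable_mult_indicator) auto
    then show ?thesis
      unfolding finite_total_curvature_def
      by (subst set_integrable_cong[OF refl refl eq]) auto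
  qed

  moreover have "omits S g1 (Some 1) \<and> omits S g1 (Some (of_real a))"
    using omits_power_quotient[OF assms(5) ne(1)] by (simp add: S assms(11) \<alpha>_def)
  moreover have "omits S g2 (Some 1) \<and> omits S g2 (Some (of_real b))"
    using omits_power_quotient[OF assms(6) ne(2)] by (simp add: S assms(12) \<beta>_def)
  ultimately show ?thesis by blast
qed

end
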